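(* Let $\mathbf{M}=\bigcup_{\mathcal F}M_i$ be a non-Hausdorff manifold built from an adjunction system $\mathcal F$ of countably many Hausdorff manifolds $M_i$ glued along open subsets $A_{ij}\subseteq M_i$, in which the gluing regions have homeomorphic boundaries. For $i\neq j$ let $g_{ij}:\boldsymbol{\partial}^iA_{ij}\to\boldsymbol{\partial}^jA_{ij}$ be the map $g_{ij}:=\phi_j\circ\tilde f_{ij}\circ\phi_i^{-1}$. Then: 1. For all $i\ne j$ the map $g_{ij}$ is a homeomorphism. 2. For all $i\neq j$ and all distinct points $[x,i]$ and $[y,j]$ of $\mathbf{M}$ (with $x\in M_i$, $y\in M_j$), we have $g_{ij}([x,i])=[y,j]$ (meaning $[x,i]\in\boldsymbol{\partial}^iA_{ij}$ and its image is $[y,j]$) if and only if $[x,i]\,\mathsf{Y}\,[y,j]$. 3. $M_j\cap\boldsymbol{\partial}M_i=M_j\cap\mathsf{Y}^{M_i}$ for all $i,j$.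
   Context: An adjunction system $\mathcal F$ indexed by a set $I$ consists of topological spaces $X_i$, subsets $A_{ij}\subseteq X_i$ (with the subspace topology) and continuous maps $f_{ij}:A_{ij}\to X_j$ such that for all $i,j,k\in I$: (A1) $A_{ii}=X_i$ and $f_{ii}=\mathrm{id}_{X_i}$; (A2) $A_{ji}=f_{ij}(A_{ij})$ and $f_{ij}^{-1}=f_{ji}$ (so $f_{ij}$ is a homeomorphism onto $A_{ji}$); (A3) for each $a\in A_{ij}\cap A_{ik}$ one has $f_{ij}(a)\in A_{jk}$ and $f_{ik}(a)=f_{jk}(f_{ij}(a))$. The adjunction space $\bigcup_{\mathcal F}X_i$ is the quotient (with the quotient topology) of the disjoint union $\bigsqcup_i X_i$ by the equivalence relation $(x,i)\cong(y,j)$ iff $x\in A_{ij}$ and $f_{ij}(x)=y$; the class of $(x,i)$ is $[x,i]$, and $\phi_i:X_i\to\bigcup_{\mathcal F}X_i$ is the canonical injective map $x\mapsto[x,i]$. All manifolds (Hausdorff or not) are locally Euclidean, second-countable and connected; a non-Hausdorff manifold is such a space that is not Hausdorff. Here the indexing set $I$ is countable, $X_i=M_i$ are Hausdorff manifolds and every $A_{ij}$ is open in $M_i$. The gluing regions have homeomorphic boundaries if, for all $i\neq j$, $A_{ij}$ is a proper subset of $M_i$ and $f_{ij}$ extends to a homeomorphism $\tilde f_{ij}:\mathrm{Cl}(A_{ij})\to\mathrm{Cl}(A_{ji})$, with closures taken in $M_i$ and $M_j$ respectively. $M_i$ is identified with the open subspace $\phi_i(M_i)$ of $\mathbf{M}$,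 and $A_{ij}$ with $\phi_i(A_{ij})=\phi_j(A_{ji})$. $\boldsymbol{\partial}$ denotes boundary in $\mathbf{M}$; $\boldsymbol{\partial}M_i:=\partial^{\mathbf M}(\phi_i(M_i))$, $\boldsymbol{\partial}^iA_{ij}:=\big(\partial^{\mathbf M}\phi_i(A_{ij})\big)\cap\phi_i(M_i)$ and $\boldsymbol{\partial}^jA_{ij}:=\big(\partial^{\mathbf M}\phi_i(A_{ij})\big)\cap\phi_j(M_j)$. For $x,y\in\mathbf{M}$, $x\mathsf{Y}y$ means every open neighbourhood of $x$ intersects every open neighbourhood of $y$. For $V\subseteq\mathbf{M}$, $\mathsf{Y}^V:=\{x\in\mathbf{M} : \exists y\in V,\ y\neq x,\ x\mathsf{Y}y\}$. *)

theory Defs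
  imports "HOL-Analysis.Analysis"
begin

definition second_countable_space :: "'a topology \<Rightarrow> bool" where
  "second_countable_space X \<longleftrightarrow>
     (\<exists>\<B>. countable \<B> \<and> (\<forall>V\<in>\<B>. openin X V) \<and>
          (\<forall>U x. openin X U \<and> x \<in> U \<longrightarrow> (\<exists>V\<in>\<B>. x \<in> V \<and> V \<subseteq> U)))"

text \<open>The dimension is allowed to depend on the point; on a connected space it cannot vary.\<close>

definition locally_Euclidean_space :: "'a topology \<Rightarrow> bool" where
  "locally_Euclidean_space X \<longleftrightarrow>
     (\<forall>x \<in> topspace X. \<exists>n U V. openin X U \<and> x \<in> U \<and> openin (Euclidean_space n) V \<and>
        subtopology X U homeomorphic_space subtopology (Euclidean_space n) V)"

definition manifold_space :: "'a topology \<Rightarrow> bool" where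
  "manifold_space X \<longleftrightarrow>
     locally_Euclidean_space X \<and> second_countable_space X \<and> connected_space X"

definition quotient_topology :: "'a topology \<Rightarrow> ('a \<times> 'a) set \<Rightarrow> 'a set topology" where
  "quotient_topology X r =
     topology (\<lambda>W. W \<subseteq> topspace X // r \<and> openin X {p \<in> topspace X. r `` {p} \<in> W})"

lemma openin_quotient_topology:
  "openin (quotient_topology X r) W \<longleftrightarrow>
     W \<subseteq> topspace X // r \<and> openin X {p \<in> topspace X. r `` {p} \<in> W}"
proof -
  have "istopology (\<lambda>W. W \<subseteq> topspace X // r \<and> openin X {p \<in> topspace X. r `` {p} \<in> W})"
    unfolding istopology_def
  proof (intro conjI allI impI)
    fix S T
    assume S: "S \<subseteq> topspace X // r \<and> openin X {p \<in> topspace X. r `` {p} \<in> S}"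
      and T: "T \<subseteq> topspace X // r \<and> openin X {p \<in> topspace X. r `` {p} \<in> T}"
    show "S \<inter> T \<subseteq> topspace X // r" using S by blast
    have "{p \<in> topspace X. r `` {p} \<in> S \<inter> T} =
        {p \<in> topspace X. r `` {p} \<in> S} \<inter> {p \<in> topspace X. r `` {p} \<in> T}" by blast
    then show "openin X {p \<in> topspace X. r `` {p} \<in> S \<inter> T}" using S T by auto
  next
    fix \<K>
    assume K: "\<forall>K\<in>\<K>. K \<subseteq> topspace X // r \<and> openin X {p \<in> topspace X. r `` {p} \<in> K}"
    show "\<Union>\<K> \<subseteq> topspace X // r" using K by blast
    have "{p \<in> topspace X. r `` {p} \<in> \<Union>\<K>} =
        \<Union>((\<lambda>K. {p \<in> topspace X. r `` {p} \<in> K}) ` \<K>)" by blast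
    then show "openin X {p \<in> topspace X. r `` {p} \<in> \<Union>\<K>}" using K by auto
  qed
  then show ?thesis
    by (simp add: quotient_topology_def topology_inverse')
qed

lemma topspace_quotient_topology: "topspace (quotient_topology X r) = topspace X // r"
proof
  show "topspace (quotient_topology X r) \<subseteq> topspace X // r"
    using openin_topspace openin_quotient_topology by blast
  have "{p \<in> topspace X. r `` {p} \<in> topspace X // r} = topspace X"
    by (auto intro: quotientI)
  then have "openin (quotient_topology X r) (topspace X // r)"
    by (simp add: openin_quotient_topology)
  then show "topspace X // r \<subseteq> topspace (quotient_topology X r)"
    by (rule openin_subset)
qed

lemma quotient_map_quotient_topology:
  "quotient_map X (quotient_topology X r) (\<lambda>p. r `` {p})"
  unfolding quotient_map_def
  by (auto simp: topspace_quotient_topology openin_quotient_topology quotient_def)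

text \<open>
  The spaces \<open>X i\<close> share a carrier type, but their underlying sets may overlap arbitrarily: they
  are made disjoint by \<^const>\<open>sum_topology\<close>, whose points are written index first, as \<open>(i, x)\<close>.
  Only the values of \<open>f i j\<close> on \<open>A i j\<close> matter.
\<close>

definition adjunction_system ::
  "'i set \<Rightarrow> ('i \<Rightarrow> 'a topology) \<Rightarrow> ('i \<Rightarrow> 'i \<Rightarrow> 'a set) \<Rightarrow> ('i \<Rightarrow> 'i \<Rightarrow> 'a \<Rightarrow> 'a) \<Rightarrow> bool" where
  "adjunction_system I X A f \<longleftrightarrow>
     (\<forall>i\<in>I. \<forall>j\<in>I. A i j \<subseteq> topspace (X i) \<and>
        continuous_map (subtopology (X i) (A i j)) (X j) (f i j)) \<and>
     (\<forall>i\<in>I. A i i = topspace (X i) \<and> (\<forall>x \<in> topspace (X i). f i i x = x)) \<and>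
     (\<forall>i\<in>I. \<forall>j\<in>I. A j i = f i j ` A i j \<and> (\<forall>x \<in> A i j. f j i (f i j x) = x)) \<and>
     (\<forall>i\<in>I. \<forall>j\<in>I. \<forall>k\<in>I. \<forall>a \<in> A i j \<inter> A i k.
        f i j a \<in> A j k \<and> f i k a = f j k (f i j a))"

definition adj_rel ::
  "'i set \<Rightarrow> ('i \<Rightarrow> 'i \<Rightarrow> 'a set) \<Rightarrow> ('i \<Rightarrow> 'i \<Rightarrow> 'a \<Rightarrow> 'a) \<Rightarrow> (('i \<times> 'a) \<times> ('i \<times> 'a)) set" where
  "adj_rel I A f = {((i, x), (j, y)) | i x j y. i \<in> I \<and> j \<in> I \<and> x \<in> A i j \<and> f i j x = y}"

definition adj_space ::
  "'i set \<Rightarrow> ('i \<Rightarrow> 'a topology) \<Rightarrow> ('i \<Rightarrow> 'i \<Rightarrow> 'a set) \<Rightarrow> ('i \<Rightarrow> 'i \<Rightarrow> 'a \<Rightarrow> 'a) \<Rightarrow> ('i \<times> 'a) set topology" where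
  "adj_space I X A f = quotient_topology (sum_topology X I) (adj_rel I A f)"

definition adj_incl ::
  "'i set \<Rightarrow> ('i \<Rightarrow> 'i \<Rightarrow> 'a set) \<Rightarrow> ('i \<Rightarrow> 'i \<Rightarrow> 'a \<Rightarrow> 'a) \<Rightarrow> 'i \<Rightarrow> 'a \<Rightarrow> ('i \<times> 'a) set" where
  "adj_incl I A f i x = adj_rel I A f `` {(i, x)}"

lemma equiv_adj_rel:
  assumes "adjunction_system I X A f"
  shows "equiv (topspace (sum_topology X I)) (adj_rel I A f)"
proof (rule equivI)
  have top: "topspace (sum_topology X I) = Sigma I (topspace \<circ> X)" by simp
  note D = assms[unfolded adjunction_system_def]
  have A1: "A i j \<subseteq> topspace (X i)" if "i \<in> I" "j \<in> I" for i j
    using D[THEN conjunct1] that by simp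
  have Ai: "A i i = topspace (X i)" "\<forall>x \<in> topspace (X i). f i i x = x" if "i \<in> I" for i
    using D[THEN conjunct2, THEN conjunct1] that by simp_all
  have A2: "A j i = f i j ` A i j" and A3: "\<forall>x \<in> A i j. f j i (f i j x) = x"
    if "i \<in> I" "j \<in> I" for i j
    using D[THEN conjunct2, THEN conjunct2, THEN conjunct1, rule_format, OF that] by simp_all
  have im: "f i j x \<in> A j i" "f j i (f i j x) = x" if "i \<in> I" "j \<in> I" "x \<in> A i j" for i j x
    using A2[of i j] A3[of i j] that by simp_all
  have co: "f i j a \<in> A j k \<and> f i k a = f j k (f i j a)"
    if "i \<in> I" "j \<in> I" "k \<in> I" "a \<in> A i j" "a \<in> A i k" for i j k a
    by (rule D[THEN conjunct2, THEN conjunct2, THEN conjunct2, rule_format, OF that(1-3) IntI[OF that(4,5)]])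
  show "adj_rel I A f \<subseteq> topspace (sum_topology X I) \<times> topspace (sum_topology X I)"
    unfolding top adj_rel_def by clarsimp (use A1 im(1) in blast)
  show "refl_on (topspace (sum_topology X I)) (adj_rel I A f)"
    unfolding top adj_rel_def refl_on_def using Ai by simp
  show "sym (adj_rel I A f)"
    unfolding adj_rel_def sym_def using im by simp
  show "trans (adj_rel I A f)"
  proof (rule transI)
    fix p q s
    assume "(p, q) \<in> adj_rel I A f" "(q, s) \<in> adj_rel I A f"
    then obtain i x j k where ps: "p = (i, x)" "s = (k, f j k (f i j x))"
      and m: "i \<in> I" "j \<in> I" "k \<in> I" "x \<in> A i j" "f i j x \<in> A j k"
      unfolding adj_rel_def by blast
    have y: "f i j x \<in> A j i" using im(1) m by simp
    have "f j i (f i j x) \<in> A i k \<and> f j k (f i j x) = f i k (f j i (f i j x))"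
      using co[of j i k "f i j x"] m y by blast
    then show "(p, s) \<in> adj_rel I A f"
      unfolding adj_rel_def using ps m im(2)[of i j x] by simp
  qed
qed

definition extends_to_closures ::
  "('i \<Rightarrow> 'a topology) \<Rightarrow> ('i \<Rightarrow> 'i \<Rightarrow> 'a set) \<Rightarrow> ('i \<Rightarrow> 'i \<Rightarrow> 'a \<Rightarrow> 'a) \<Rightarrow> 'i \<Rightarrow> 'i \<Rightarrow> ('a \<Rightarrow> 'a) \<Rightarrow> bool" where
  "extends_to_closures X A f i j h \<longleftrightarrow>
     homeomorphic_map (subtopology (X i) (X i closure_of A i j))
                      (subtopology (X j) (X j closure_of A j i)) h \<and>
     (\<forall>x \<in> A i j. h x = f i j x)"

definition homeomorphic_boundaries ::
  "'i set \<Rightarrow> ('i \<Rightarrow> 'a topology) \<Rightarrow> ('i \<Rightarrow> 'i \<Rightarrow> 'a set) \<Rightarrow> ('i \<Rightarrow> 'i \<Rightarrow> 'a \<Rightarrow> 'a) \<Rightarrow> bool" where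
  "homeomorphic_boundaries I X A f \<longleftrightarrow>
     (\<forall>i\<in>I. \<forall>j\<in>I. i \<noteq> j \<longrightarrow>
        A i j \<subset> topspace (X i) \<and> (\<exists>h. extends_to_closures X A f i j h))"

text \<open>
  \<open>glue_bd I X A f i j k\<close>, used with \<open>k = i\<close> and \<open>k = j\<close>, is the part in the \<open>k\<close>-th piece of the
  boundary, taken in the adjunction space, of the glued region \<open>A i j\<close>.
\<close>

definition glue_bd ::
  "'i set \<Rightarrow> ('i \<Rightarrow> 'a topology) \<Rightarrow> ('i \<Rightarrow> 'i \<Rightarrow> 'a set) \<Rightarrow> ('i \<Rightarrow> 'i \<Rightarrow> 'a \<Rightarrow> 'a)
     \<Rightarrow> 'i \<Rightarrow> 'i \<Rightarrow> 'i \<Rightarrow> ('i \<times> 'a) set set" where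
  "glue_bd I X A f i j k =
     (adj_space I X A f frontier_of (adj_incl I A f i ` A i j))
       \<inter> adj_incl I A f k ` topspace (X k)"

text \<open>\<open>ft i j\<close> is the extension of \<open>f i j\<close> to the closure of \<open>A i j\<close>.\<close>

definition glue_map ::
  "'i set \<Rightarrow> ('i \<Rightarrow> 'a topology) \<Rightarrow> ('i \<Rightarrow> 'i \<Rightarrow> 'a set) \<Rightarrow> ('i \<Rightarrow> 'i \<Rightarrow> 'a \<Rightarrow> 'a)
     \<Rightarrow> ('i \<Rightarrow> 'i \<Rightarrow> 'a \<Rightarrow> 'a) \<Rightarrow> 'i \<Rightarrow> 'i \<Rightarrow> ('i \<times> 'a) set \<Rightarrow> ('i \<times> 'a) set" where
  "glue_map I X A f ft i j =
     adj_incl I A f j \<circ> ft i j \<circ> inv_into (topspace (X i)) (adj_incl I A f i)"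

definition Yrel :: "'a topology \<Rightarrow> 'a \<Rightarrow> 'a \<Rightarrow> bool" where
  "Yrel M x y \<longleftrightarrow> x \<in> topspace M \<and> y \<in> topspace M \<and>
     (\<forall>U V. openin M U \<and> x \<in> U \<and> openin M V \<and> y \<in> V \<longrightarrow> U \<inter> V \<noteq> {})"

definition Yset :: "'a topology \<Rightarrow> 'a set \<Rightarrow> 'a set" where
  "Yset M V = {x \<in> topspace M. \<exists>y\<in>V. y \<noteq> x \<and> Yrel M x y}"

end

theory Submission
  imports Defs
begin

text \<open>
  The inclusions \<open>\<phi> i\<close> are open embeddings, so closures and neighbourhoods in the adjunction space
  can be computed inside the pieces. Thus the boundary of the glued region inside the \<open>i\<close>-th piece
  is \<open>\<phi> i ` (Cl (A i j) - A i j)\<close>, and the extension of \<open>f i j\<close> matches these sets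
  because it already matches \<open>A i j\<close> with \<open>A j i\<close>. Moreover \<open>\<phi> i x\<close> and \<open>\<phi> j y\<close> cannot be
  separated iff arbitrarily near \<open>x\<close> there are points of \<open>A i j\<close> that \<open>f i j\<close> sends arbitrarily near
  \<open>y\<close>. As the pieces are Hausdorff and the extension is continuous, for distinct points this
  means that \<open>x\<close> lies on the boundary of \<open>A i j\<close> and is sent to \<open>y\<close>.
\<close>

section \<open>Non-separated points and extensions to closures in general spaces\<close>

lemma Yrel_sym: "Yrel M x y \<Longrightarrow> Yrel M y x"
  unfolding Yrel_def by (metis inf_commute)

text \<open>Since \<open>U\<close> is open, disjoint neighbourhoods found inside \<open>U\<close>
  are also open in \<open>M\<close>, where they would contradict \<open>Yrel\<close>.\<close>

lemma Yrel_Hausdorff_open_eq: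
  assumes "openin M U" "Hausdorff_space (subtopology M U)" "x \<in> U" "y \<in> U" "Yrel M x y"
  shows "x = y"
proof (rule ccontr)
  assume "x \<noteq> y"
  then obtain V W where "openin (subtopology M U) V" "openin (subtopology M U) W"
      "x \<in> V" "y \<in> W" "disjnt V W"
    using assms(2-4) topspace_subtopology_subset[OF openin_subset[OF assms(1)]]
    unfolding Hausdorff_space_def by metis
  with \<open>Yrel M x y\<close> show False
    unfolding Yrel_def disjnt_def using openin_open_subtopology[OF assms(1)] by blast
qed

text \<open>The extension is a bijection between the closures that restricts to a bijection from
  \<open>A i j\<close> to \<open>A j i\<close>, so it must match the complements too.\<close>

lemma extends_to_closures_frontier:
  assumes "extends_to_closures X A f i j h" "f i j ` A i j = A j i"
    and "A i j \<subseteq> topspace (X i)" "A j i \<subseteq> topspace (X j)"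
  shows "h ` (X i closure_of A i j - A i j) = X j closure_of A j i - A j i"
proof -
  have hom: "homeomorphic_map (subtopology (X i) (X i closure_of A i j))
      (subtopology (X j) (X j closure_of A j i)) h" and h: "\<forall>x \<in> A i j. h x = f i j x"
    using assms(1) by (auto simp: extends_to_closures_def)
  have top: "topspace (subtopology (X k) (X k closure_of S)) = X k closure_of S" for k S
    by (simp add: Int_absorb1 closure_of_subset_topspace)
  have "inj_on h (X i closure_of A i j)" "h ` (X i closure_of A i j) = X j closure_of A j i"
    using hom unfolding homeomorphic_eq_everything_map top by auto
  moreover have "h ` A i j = A j i" using h assms(2) by force
  moreover have "A i j \<subseteq> X i closure_of A i j" by (rule closure_of_subset[OF assms(3)])
  ultimately show ?thesis
    by (metis Diff_subset inj_on_image_set_diff)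
qed

section \<open>The inclusions of the pieces as open embeddings\<close>

locale open_adjunction =
  fixes I :: "'i set"
    and X :: "'i \<Rightarrow> 'a topology"
    and A :: "'i \<Rightarrow> 'i \<Rightarrow> 'a set"
    and f :: "'i \<Rightarrow> 'i \<Rightarrow> 'a \<Rightarrow> 'a"
  assumes adj: "adjunction_system I X A f"
    and open_A: "\<And>i j. \<lbrakk>i \<in> I; j \<in> I\<rbrakk> \<Longrightarrow> openin (X i) (A i j)"
begin

abbreviation "M \<equiv> adj_space I X A f"
abbreviation "\<phi> \<equiv> adj_incl I A f"

lemma A_subset: "\<lbrakk>i \<in> I; j \<in> I\<rbrakk> \<Longrightarrow> A i j \<subseteq> topspace (X i)"
  and f_continuous: "\<lbrakk>i \<in> I; j \<in> I\<rbrakk> \<Longrightarrow> continuous_map (subtopology (X i) (A i j)) (X j) (f i j)"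
  using adj[unfolded adjunction_system_def, THEN conjunct1] by simp_all

lemma f_image: "\<lbrakk>i \<in> I; j \<in> I\<rbrakk> \<Longrightarrow> f i j ` A i j = A j i"
  using adj[unfolded adjunction_system_def, THEN conjunct2, THEN conjunct2, THEN conjunct1, rule_format, of i j]
  by simp

lemma f_refl: "\<lbrakk>i \<in> I; x \<in> topspace (X i)\<rbrakk> \<Longrightarrow> x \<in> A i i \<and> f i i x = x"
  using adj[unfolded adjunction_system_def, THEN conjunct2, THEN conjunct1] by simp

lemma f_in: "\<lbrakk>i \<in> I; j \<in> I; x \<in> A i j\<rbrakk> \<Longrightarrow> f i j x \<in> A j i"
  using f_image by blast

text \<open>Classes of an equivalence relation coincide exactly when their representatives are
  related. Questions about coinciding points of \<open>M\<close> are reduced through this to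
  \<open>A\<close> and \<open>f\<close>.\<close>

lemma incl_eq_iff:
  assumes "i \<in> I" "j \<in> I" "x \<in> topspace (X i)" "y \<in> topspace (X j)"
  shows "\<phi> i x = \<phi> j y \<longleftrightarrow> x \<in> A i j \<and> f i j x = y"
proof -
  have "\<phi> i x = \<phi> j y \<longleftrightarrow> ((i, x), (j, y)) \<in> adj_rel I A f"
    unfolding adj_incl_def using assms
    by (intro eq_equiv_class_iff[OF equiv_adj_rel[OF adj]]) auto
  then show ?thesis using assms by (auto simp: adj_rel_def)
qed

lemma inj_incl: "i \<in> I \<Longrightarrow> inj_on (\<phi> i) (topspace (X i))"
  using f_refl incl_eq_iff[of i i] by (intro inj_onI) simp

lemma incl_f: "\<lbrakk>i \<in> I; j \<in> I; x \<in> A i j\<rbrakk> \<Longrightarrow> \<phi> j (f i j x) = \<phi> i x"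
  using incl_eq_iff[of i j x "f i j x"] A_subset[of i j] A_subset[of j i] f_in[of i j x] by auto

lemma incl_image_A: "\<lbrakk>i \<in> I; j \<in> I\<rbrakk> \<Longrightarrow> \<phi> i ` A i j = \<phi> j ` A j i"
  unfolding f_image[of i j, symmetric] image_image using incl_f by (intro image_cong) simp_all

lemma incl_images_Int:
  assumes "i \<in> I" "j \<in> I"
  shows "\<phi> i ` topspace (X i) \<inter> \<phi> j ` topspace (X j) = \<phi> i ` A i j"
proof
  show "\<phi> i ` topspace (X i) \<inter> \<phi> j ` topspace (X j) \<subseteq> \<phi> i ` A i j"
    using incl_eq_iff[OF assms] by auto
  show "\<phi> i ` A i j \<subseteq> \<phi> i ` topspace (X i) \<inter> \<phi> j ` topspace (X j)"
    using image_mono[OF A_subset[OF assms(2,1)], of "\<phi> j"] incl_image_A[OF assms]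
    by (intro Int_greatest image_mono A_subset assms) simp
qed

lemma continuous_incl: "i \<in> I \<Longrightarrow> continuous_map (X i) M (\<phi> i)"
proof -
  assume "i \<in> I"
  have "continuous_map (X i) M ((\<lambda>p. adj_rel I A f `` {p}) \<circ> (\<lambda>x. (i, x)))"
    unfolding adj_space_def
    by (rule continuous_map_compose[OF continuous_map_component_injection[OF \<open>i \<in> I\<close>]
          quotient_imp_continuous_map[OF quotient_map_quotient_topology]])
  then show ?thesis by (simp add: o_def adj_incl_def[abs_def])
qed

lemma open_map_incl:
  assumes i: "i \<in> I"
  shows "open_map (X i) M (\<phi> i)"
  unfolding open_map_def
proof (intro allI impI)
  fix W assume W: "openin (X i) W"
  have sub: "W \<subseteq> topspace (X i)" by (rule openin_subset[OF W])
  have "\<phi> i ` W \<subseteq> topspace M"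
    using continuous_map_image_subset_topspace[OF continuous_incl[OF i]] sub by blast
  moreover have "openin (X j) {y. (j, y) \<in> {p \<in> topspace (sum_topology X I). adj_rel I A f `` {p} \<in> \<phi> i ` W}}"
    if j: "j \<in> I" for j
  proof -
    have "\<phi> j y \<in> \<phi> i ` W \<longleftrightarrow> y \<in> A j i \<and> f j i y \<in> W" if "y \<in> topspace (X j)" for y
    proof -
      have "\<phi> j y = \<phi> i x \<longleftrightarrow> y \<in> A j i \<and> f j i y = x" if "x \<in> W" for x
        using incl_eq_iff[OF j i \<open>y \<in> topspace (X j)\<close>] that sub by blast
      then show ?thesis by (auto simp: image_iff)
    qed
    then have eq: "{y. (j, y) \<in> {p \<in> topspace (sum_topology X I). adj_rel I A f `` {p} \<in> \<phi> i ` W}}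
        = {y \<in> topspace (subtopology (X j) (A j i)). f j i y \<in> W}"
      using j A_subset[OF j i] by (auto simp: adj_incl_def)
    have "openin (subtopology (X j) (A j i)) {y \<in> topspace (subtopology (X j) (A j i)). f j i y \<in> W}"
      using f_continuous[OF j i] W by (rule openin_continuous_map_preimage)
    then show ?thesis
      unfolding eq using openin_open_subtopology[OF open_A[OF j i]] by blast
  qed
  ultimately show "openin M (\<phi> i ` W)"
    unfolding adj_space_def openin_quotient_topology topspace_quotient_topology openin_sum_topology
    by auto
qed

lemma openin_incl_image: "\<lbrakk>i \<in> I; openin (X i) U\<rbrakk> \<Longrightarrow> openin M (\<phi> i ` U)"
  using open_map_incl by (simp add: open_map_def)

lemma homeomorphic_incl:
  "i \<in> I \<Longrightarrow> homeomorphic_map (X i) (subtopology M (\<phi> i ` topspace (X i))) (\<phi> i)"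
  using injective_open_imp_embedding_map[OF continuous_incl open_map_incl inj_incl]
  by (simp add: embedding_map_def)

lemma homeomorphic_incl_restrict:
  assumes i: "i \<in> I" and D: "D \<subseteq> topspace (X i)"
  shows "homeomorphic_map (subtopology (X i) D) (subtopology M (\<phi> i ` D)) (\<phi> i)"
proof -
  have "\<phi> i ` D \<subseteq> \<phi> i ` topspace (X i)" using D by blast
  moreover have "\<phi> i ` topspace (X i) \<subseteq> topspace M"
    by (rule continuous_map_image_subset_topspace[OF continuous_incl[OF i]])
  ultimately have "homeomorphic_map (subtopology (X i) D)
      (subtopology (subtopology M (\<phi> i ` topspace (X i))) (\<phi> i ` D)) (\<phi> i)"
    using D by (intro homeomorphic_map_subtopologies[OF homeomorphic_incl[OF i]])
      (simp add: Int_absorb1 Int_absorb2)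
  then show ?thesis
    using \<open>\<phi> i ` D \<subseteq> \<phi> i ` topspace (X i)\<close> by (simp add: subtopology_subtopology Int_absorb1)
qed

lemma homeomorphic_inv_incl:
  assumes i: "i \<in> I" and D: "D \<subseteq> topspace (X i)"
  shows "homeomorphic_map (subtopology M (\<phi> i ` D)) (subtopology (X i) D)
           (inv_into (topspace (X i)) (\<phi> i))"
proof -
  obtain g where g: "homeomorphic_maps (subtopology (X i) D) (subtopology M (\<phi> i ` D)) (\<phi> i) g"
    using homeomorphic_incl_restrict[OF assms] homeomorphic_map_maps by blast
  have "g y = inv_into (topspace (X i)) (\<phi> i) y" if "y \<in> topspace (subtopology M (\<phi> i ` D))" for y
  proof -
    have "y \<in> \<phi> i ` D" using that by simp
    then obtain x where "x \<in> D" "y = \<phi> i x" by blast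
    then show ?thesis
      using g D inj_incl[OF i] unfolding homeomorphic_maps_def
      by (auto simp: Int_absorb1 inv_into_f_f)
  qed
  then show ?thesis
    using g homeomorphic_map_eq unfolding homeomorphic_maps_map by blast
qed

section \<open>Boundaries of the glued regions and the maps between them\<close>

text \<open>The closure relative to an open subspace is the trace of the ambient closure, and
  \<open>\<phi> i\<close> is a homeomorphism onto an open subspace.\<close>

lemma closure_of_incl_image:
  assumes i: "i \<in> I" and S: "S \<subseteq> topspace (X i)"
  shows "\<phi> i ` topspace (X i) \<inter> M closure_of (\<phi> i ` S) = \<phi> i ` (X i closure_of S)"
  using homeomorphic_map_closure_of[OF homeomorphic_incl[OF i] S] S
    closure_of_subtopology_open[of M "\<phi> i ` topspace (X i)" "\<phi> i ` S"]
  by (metis image_mono)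

text \<open>The glued region is open in \<open>M\<close>, so its frontier is its closure minus
  itself; both are then pulled back along \<open>\<phi> i\<close>.\<close>

lemma glue_bd_left:
  assumes i: "i \<in> I" and j: "j \<in> I"
  shows "glue_bd I X A f i j i = \<phi> i ` (X i closure_of A i j - A i j)"
proof -
  have "M interior_of (\<phi> i ` A i j) = \<phi> i ` A i j"
    using openin_incl_image[OF i open_A[OF i j]] by (rule interior_of_openin)
  then have "glue_bd I X A f i j i
      = (\<phi> i ` topspace (X i) \<inter> M closure_of (\<phi> i ` A i j)) - \<phi> i ` A i j"
    unfolding glue_bd_def frontier_of_def by blast
  also have "\<dots> = \<phi> i ` (X i closure_of A i j) - \<phi> i ` A i j"
    by (simp only: closure_of_incl_image[OF i A_subset[OF i j]])
  also have "\<dots> = \<phi> i ` (X i closure_of A i j - A i j)"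
    by (rule inj_on_image_set_diff[OF inj_incl[OF i], symmetric])
      (use A_subset[OF i j] closure_of_subset_topspace[of "X i" "A i j"] in blast)+
  finally show ?thesis .
qed

text \<open>The glued region is the same subset of \<open>M\<close> seen from either piece, so the
  indices may be exchanged.\<close>

lemma glue_bd_right:
  assumes "i \<in> I" "j \<in> I"
  shows "glue_bd I X A f i j j = \<phi> j ` (X j closure_of A j i - A j i)"
  using glue_bd_left[of j i] incl_image_A[of i j] assms by (simp add: glue_bd_def)

lemma glue_map_incl:
  "\<lbrakk>i \<in> I; x \<in> topspace (X i)\<rbrakk> \<Longrightarrow> glue_map I X A f ft i j (\<phi> i x) = \<phi> j (ft i j x)"
  by (simp add: glue_map_def inv_into_f_f inj_incl)

text \<open>Each of the three factors of \<open>glue_map\<close> restricts to a homeomorphism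
  between the boundary parts, and these restrictions compose.\<close>

lemma homeomorphic_glue_map:
  assumes i: "i \<in> I" and j: "j \<in> I" and ext: "extends_to_closures X A f i j (ft i j)"
  shows "homeomorphic_map (subtopology M (glue_bd I X A f i j i))
           (subtopology M (glue_bd I X A f i j j)) (glue_map I X A f ft i j)"
proof -
  let ?Ci = "X i closure_of A i j" and ?Cj = "X j closure_of A j i"
  let ?Di = "?Ci - A i j" and ?Dj = "?Cj - A j i"
  have Di: "?Di \<subseteq> topspace (X i)" and Dj: "?Dj \<subseteq> topspace (X j)"
    using closure_of_subset_topspace by fastforce+
  have hD: "ft i j ` ?Di = ?Dj"
    by (intro extends_to_closures_frontier[OF ext] f_image A_subset i j)
  \<comment> \<open>The extension is a homeomorphism only between closures, so it is restricted
    inside them first; the nested subspaces collapse afterwards.\<close>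
  have "homeomorphic_map (subtopology (subtopology (X i) ?Ci) ?Di)
      (subtopology (subtopology (X j) ?Cj) ?Dj) (ft i j)"
  proof (rule homeomorphic_map_subtopologies)
    show "homeomorphic_map (subtopology (X i) ?Ci) (subtopology (X j) ?Cj) (ft i j)"
      using ext by (simp add: extends_to_closures_def)
    have "topspace (subtopology (X i) ?Ci) \<inter> ?Di = ?Di" "topspace (subtopology (X j) ?Cj) \<inter> ?Dj = ?Dj"
      using Di Dj by auto
    then show "ft i j ` (topspace (subtopology (X i) ?Ci) \<inter> ?Di)
        = topspace (subtopology (X j) ?Cj) \<inter> ?Dj"
      using hD by simp
  qed
  then have "homeomorphic_map (subtopology (X i) ?Di) (subtopology (X j) ?Dj) (ft i j)"
    by (simp add: subtopology_subtopology Int_absorb1)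
  from homeomorphic_map_compose[OF homeomorphic_map_compose[OF homeomorphic_inv_incl[OF i Di] this]
      homeomorphic_incl_restrict[OF j Dj]]
  have "homeomorphic_map (subtopology M (\<phi> i ` ?Di)) (subtopology M (\<phi> j ` ?Dj))
      (\<phi> j \<circ> (ft i j \<circ> inv_into (topspace (X i)) (\<phi> i)))" .
  then show ?thesis
    by (simp add: glue_bd_left glue_bd_right i j glue_map_def o_assoc)
qed

section \<open>Non-separated points described in the pieces\<close>

text \<open>Neighbourhoods pass to \<open>M\<close> because the inclusions are open and back because
  they are continuous. A common point of \<open>\<phi> i\<close> U\<open>and\<close>\<phi> j
  \<open>V\<close> is a point \<open>a\<close> of \<open>A i j\<close> in \<open>U\<close> with
  \<open>f i j a\<close> in \<open>V\<close>.\<close>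

lemma Yrel_incl_iff:
  assumes i: "i \<in> I" and j: "j \<in> I" and x: "x \<in> topspace (X i)" and y: "y \<in> topspace (X j)"
  shows "Yrel M (\<phi> i x) (\<phi> j y) \<longleftrightarrow>
    (\<forall>U V. openin (X i) U \<and> x \<in> U \<and> openin (X j) V \<and> y \<in> V \<longrightarrow> (\<exists>a \<in> U \<inter> A i j. f i j a \<in> V))"
    (is "_ \<longleftrightarrow> ?R")
proof
  assume Y: "Yrel M (\<phi> i x) (\<phi> j y)"
  show ?R
  proof (intro allI impI)
    fix U V assume UV: "openin (X i) U \<and> x \<in> U \<and> openin (X j) V \<and> y \<in> V"
    then have "\<phi> i ` U \<inter> \<phi> j ` V \<noteq> {}"
      using Y openin_incl_image i j unfolding Yrel_def by (metis imageI)
    then obtain a b where ab: "a \<in> U" "b \<in> V" "\<phi> i a = \<phi> j b" by blast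
    then have "a \<in> A i j \<and> f i j a = b"
      using incl_eq_iff[OF i j] UV openin_subset by (metis subsetD)
    with ab show "\<exists>a \<in> U \<inter> A i j. f i j a \<in> V" by blast
  qed
next
  assume R: ?R
  show "Yrel M (\<phi> i x) (\<phi> j y)"
    unfolding Yrel_def
  proof (intro conjI allI impI)
    show "\<phi> i x \<in> topspace M" "\<phi> j y \<in> topspace M"
      using continuous_map_image_subset_topspace[OF continuous_incl] i j x y by blast+
    fix U V assume UV: "openin M U \<and> \<phi> i x \<in> U \<and> openin M V \<and> \<phi> j y \<in> V"
    let ?U = "{a \<in> topspace (X i). \<phi> i a \<in> U}" and ?V = "{b \<in> topspace (X j). \<phi> j b \<in> V}"
    have "openin (X i) ?U" "openin (X j) ?V"
      using openin_continuous_map_preimage[OF continuous_incl] UV i j by blast+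
    moreover have "x \<in> ?U" "y \<in> ?V" using UV x y by auto
    ultimately obtain a where "a \<in> ?U \<inter> A i j" "f i j a \<in> ?V"
      using R[rule_format, of ?U ?V] by blast
    then have "a \<in> A i j" "\<phi> i a \<in> U" "\<phi> j (f i j a) \<in> V" by auto
    then show "U \<inter> V \<noteq> {}" using incl_f[OF i j] by auto
  qed
qed

end

section \<open>Hausdorff pieces: non-separation through the extended gluing maps\<close>

locale Hausdorff_open_adjunction = open_adjunction +
  assumes Hausdorff: "\<And>i. i \<in> I \<Longrightarrow> Hausdorff_space (X i)"
begin

lemma Yrel_same_piece_eq:
  assumes "i \<in> I" "p \<in> \<phi> i ` topspace (X i)" "q \<in> \<phi> i ` topspace (X i)" "Yrel M p q"
  shows "p = q"
proof (rule Yrel_Hausdorff_open_eq[OF _ _ assms(2-4)])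
  show "openin M (\<phi> i ` topspace (X i))"
    by (simp add: openin_incl_image assms(1))
  show "Hausdorff_space (subtopology M (\<phi> i ` topspace (X i)))"
    using Hausdorff[OF assms(1)] homeomorphic_incl[OF assms(1)]
      homeomorphic_Hausdorff_space homeomorphic_map_imp_homeomorphic_space by blast
qed

text \<open>Continuity of \<open>h\<close> makes \<open>f i j\<close> send the points of
  \<open>A i j\<close> near \<open>x\<close> close to \<open>h x\<close>, while \<open>X j\<close>
  being Hausdorff leaves \<open>h x\<close> as the only possible partner of \<open>x\<close>
  there.\<close>

lemma Yrel_iff_extension:
  assumes i: "i \<in> I" and j: "j \<in> I" and ext: "extends_to_closures X A f i j h"
    and x: "x \<in> topspace (X i)" and y: "y \<in> topspace (X j)" and ne: "\<phi> i x \<noteq> \<phi> j y"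
  shows "Yrel M (\<phi> i x) (\<phi> j y) \<longleftrightarrow> x \<in> X i closure_of A i j - A i j \<and> h x = y"
proof -
  let ?C = "X i closure_of A i j"
  have h: "h a = f i j a" if "a \<in> A i j" for a
    using ext that by (simp add: extends_to_closures_def)
  have cont: "continuous_map (subtopology (X i) ?C) (X j) h"
    using ext by (auto simp: extends_to_closures_def
        dest: homeomorphic_imp_continuous_map continuous_map_into_fulltopology)
  \<comment> \<open>This restates continuity of \<open>h\<close> at a closure point purely in terms
    of \<open>f i j\<close>; both directions below rely on it.\<close>
  have near: "\<exists>W. openin (X i) W \<and> x \<in> W \<and> (\<forall>a \<in> W \<inter> A i j. f i j a \<in> V)"
    if "x \<in> ?C" "openin (X j) V" "h x \<in> V" for V
  proof -
    have "openin (subtopology (X i) ?C) {a \<in> topspace (subtopology (X i) ?C). h a \<in> V}"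
      using cont that(2) by (rule openin_continuous_map_preimage)
    then obtain W where W: "openin (X i) W"
        "{a \<in> topspace (subtopology (X i) ?C). h a \<in> V} = W \<inter> ?C"
      unfolding openin_subtopology by blast
    have "x \<in> W" using W(2) that x by auto
    moreover have "f i j a \<in> V" if "a \<in> W \<inter> A i j" for a
    proof -
      have "a \<in> W \<inter> ?C" using that closure_of_subset[OF A_subset[OF i j]] by blast
      then have "h a \<in> V" using W(2) by blast
      then show ?thesis using h that by simp
    qed
    ultimately show ?thesis using W(1) by blast
  qed
  show ?thesis
  proof
    assume Y: "Yrel M (\<phi> i x) (\<phi> j y)"
    note Y' = Y[unfolded Yrel_incl_iff[OF i j x y], rule_format]
    \<comment> \<open>Choosing all of \<open>X j\<close> as the neighbourhood of \<open>y\<close>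
      leaves only the statement that every neighbourhood of \<open>x\<close> meets
      \<open>A i j\<close>.\<close>
    have "\<exists>a \<in> U \<inter> A i j. f i j a \<in> topspace (X j)" if "openin (X i) U" "x \<in> U" for U
      using that y by (intro Y') auto
    then have "x \<in> ?C" using x by (auto simp: in_closure_of)
    \<comment> \<open>Otherwise both points would lie in the Hausdorff piece \<open>j\<close> and so
      coincide, against \<open>ne\<close>.\<close>
    moreover have "x \<notin> A i j"
    proof
      assume "x \<in> A i j"
      then have "\<phi> i x \<in> \<phi> j ` topspace (X j)"
        using incl_image_A[OF i j] A_subset[OF j i] by blast
      then show False using Yrel_same_piece_eq[OF j _ _ Y] y ne by blast
    qed
    moreover have "h x = y"
    proof (rule ccontr)
      assume "h x \<noteq> y"
      have "x \<in> topspace (subtopology (X i) ?C)" using x \<open>x \<in> ?C\<close> by simp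
      then have "h x \<in> topspace (X j)"
        using continuous_map_image_subset_topspace[OF cont] by blast
      with \<open>h x \<noteq> y\<close> y obtain V V' where V: "openin (X j) V" "openin (X j) V'" "h x \<in> V" "y \<in> V'" "disjnt V V'"
        using Hausdorff[OF j] unfolding Hausdorff_space_def by blast
      \<comment> \<open>All of \<open>W \<inter> A i j\<close> is sent into \<open>V\<close>, yet
        \<open>Yrel\<close> yields a point of it sent into the disjoint set
        \<open>V'\<close>.\<close>
      obtain W where W: "openin (X i) W" "x \<in> W" "\<forall>a \<in> W \<inter> A i j. f i j a \<in> V"
        using near[OF \<open>x \<in> ?C\<close> V(1,3)] by blast
      have "\<exists>a \<in> W \<inter> A i j. f i j a \<in> V'"
        using W V by (intro Y') auto
      with W V show False by (auto simp: disjnt_iff)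
    qed
    ultimately show "x \<in> ?C - A i j \<and> h x = y" by blast
  next
    assume R: "x \<in> ?C - A i j \<and> h x = y"
    show "Yrel M (\<phi> i x) (\<phi> j y)"
      unfolding Yrel_incl_iff[OF i j x y]
    proof (intro allI impI)
      fix U V assume UV: "openin (X i) U \<and> x \<in> U \<and> openin (X j) V \<and> y \<in> V"
      then obtain W where W: "openin (X i) W" "x \<in> W" "\<forall>a \<in> W \<inter> A i j. f i j a \<in> V"
        using near[of V] R by blast
      \<comment> \<open>As \<open>x\<close> is a closure point, \<open>U \<inter> W\<close> meets
        \<open>A i j\<close>, and membership in \<open>W\<close> puts the image in
        \<open>V\<close>.\<close>
      have "openin (X i) (U \<inter> W)" "x \<in> U \<inter> W" using UV W by auto
      moreover have "x \<in> ?C" using R by simp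
      ultimately obtain a where "a \<in> A i j" "a \<in> U \<inter> W"
        unfolding in_closure_of by meson
      then show "\<exists>a \<in> U \<inter> A i j. f i j a \<in> V" using W by blast
    qed
  qed
qed

lemma frontier_of_piece_eq_Yset:
  assumes i: "i \<in> I" and j: "j \<in> I" and ext: "i \<noteq> j \<Longrightarrow> extends_to_closures X A f i j h"
  shows "\<phi> j ` topspace (X j) \<inter> M frontier_of (\<phi> i ` topspace (X i))
       = \<phi> j ` topspace (X j) \<inter> Yset M (\<phi> i ` topspace (X i))"
    (is "?Pj \<inter> M frontier_of ?Pi = _")
proof -
  have open_P: "openin M (\<phi> k ` topspace (X k))" if "k \<in> I" for k
    using openin_incl_image that by blast
  show ?thesis
  proof (cases "i = j")
    case True
    \<comment> \<open>With equal indices both sides are empty: a Hausdorff piece contains no two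
      distinct non-separated points, and an open set misses its own frontier.\<close>
    have "?Pi \<inter> Yset M ?Pi = {}"
      using Yrel_same_piece_eq[OF i] by (auto simp: Yset_def)
    moreover have "?Pi \<inter> M frontier_of ?Pi = {}"
      using interior_of_openin[OF open_P[OF i]] by (auto simp: frontier_of_def)
    ultimately show ?thesis using True by simp
  next
    case False
    note ext = ext[OF False]
    have hD: "h ` (X i closure_of A i j - A i j) = X j closure_of A j i - A j i"
      by (intro extends_to_closures_frontier[OF ext] f_image A_subset i j)
    have Pji: "?Pj \<inter> ?Pi = \<phi> j ` A j i" by (rule incl_images_Int[OF j i])
    \<comment> \<open>Inside the open set \<open>?Pj\<close>, the closure of \<open>?Pi\<close>
      depends only on the overlap \<open>?Pj \<inter> ?Pi\<close>.\<close>
    have "?Pj \<inter> M closure_of ?Pi = ?Pj \<inter> M closure_of (\<phi> j ` A j i)"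
      using openin_Int_closure_of_eq[OF open_P[OF j], of ?Pi] Pji by simp
    also have "\<dots> = \<phi> j ` (X j closure_of A j i)"
      by (rule closure_of_incl_image[OF j A_subset[OF j i]])
    finally have cl: "?Pj \<inter> M closure_of ?Pi = \<phi> j ` (X j closure_of A j i)" .
    have mem: "\<phi> j y \<in> M frontier_of ?Pi \<longleftrightarrow> \<phi> j y \<in> Yset M ?Pi" if y: "y \<in> topspace (X j)" for y
    proof -
      have y': "\<phi> j y \<in> ?Pj" using y by (rule imageI)
      have "\<phi> j y \<in> M closure_of ?Pi \<longleftrightarrow> \<phi> j y \<in> \<phi> j ` (X j closure_of A j i)"
        using y' unfolding cl[symmetric] by simp
      also have "\<dots> \<longleftrightarrow> y \<in> X j closure_of A j i"
        by (rule inj_on_image_mem_iff[OF inj_incl[OF j] y closure_of_subset_topspace])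
      finally have in_cl: "\<phi> j y \<in> M closure_of ?Pi \<longleftrightarrow> y \<in> X j closure_of A j i" .
      have "\<phi> j y \<in> ?Pi \<longleftrightarrow> \<phi> j y \<in> \<phi> j ` A j i"
        using y' unfolding Pji[symmetric] by simp
      also have "\<dots> \<longleftrightarrow> y \<in> A j i"
        by (rule inj_on_image_mem_iff[OF inj_incl[OF j] y A_subset[OF j i]])
      finally have in_Pi: "\<phi> j y \<in> ?Pi \<longleftrightarrow> y \<in> A j i" .
      have in_fr: "\<phi> j y \<in> M frontier_of ?Pi \<longleftrightarrow> y \<in> X j closure_of A j i - A j i"
        using in_cl in_Pi interior_of_openin[OF open_P[OF i]] by (simp add: frontier_of_def)
      show ?thesis
      proof
        assume "\<phi> j y \<in> M frontier_of ?Pi"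
        then have y_bd: "y \<in> X j closure_of A j i - A j i" using in_fr by simp
        then obtain x where x: "x \<in> X i closure_of A i j - A i j" "h x = y"
          unfolding hD[symmetric] by blast
        have xX: "x \<in> topspace (X i)" using x(1) closure_of_subset_topspace by fastforce
        \<comment> \<open>Equality would place \<open>\<phi> j y\<close> in \<open>?Pi\<close>,
          hence \<open>y\<close> in \<open>A j i\<close>.\<close>
        have ne: "\<phi> i x \<noteq> \<phi> j y" using in_Pi y_bd xX by force
        have "Yrel M (\<phi> i x) (\<phi> j y)"
          using Yrel_iff_extension[OF i j ext xX y ne] x by simp
        then have "Yrel M (\<phi> j y) (\<phi> i x)" by (rule Yrel_sym)
        then show "\<phi> j y \<in> Yset M ?Pi"
          using ne xX by (auto simp: Yset_def Yrel_def)
      next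
        assume "\<phi> j y \<in> Yset M ?Pi"
        then obtain x where x: "x \<in> topspace (X i)" "\<phi> i x \<noteq> \<phi> j y" "Yrel M (\<phi> j y) (\<phi> i x)"
          unfolding Yset_def by blast
        then have "x \<in> X i closure_of A i j - A i j \<and> h x = y"
          using Yrel_iff_extension[OF i j ext x(1) y] Yrel_sym by metis
        then have "y \<in> X j closure_of A j i - A j i" unfolding hD[symmetric] by blast
        then show "\<phi> j y \<in> M frontier_of ?Pi" using in_fr by simp
      qed
    qed
    then show ?thesis by blast
  qed
qed

end

theorem lemma2p3:
  fixes I :: "'i set"
    and X :: "'i \<Rightarrow> 'a topology"
    and A :: "'i \<Rightarrow> 'i \<Rightarrow> 'a set"
    and f ft :: "'i \<Rightarrow> 'i \<Rightarrow> 'a \<Rightarrow> 'a"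
  assumes "countable I"
    and "adjunction_system I X A f"
    and "\<And>i. i \<in> I \<Longrightarrow> manifold_space (X i) \<and> Hausdorff_space (X i)"
    and "\<And>i j. i \<in> I \<Longrightarrow> j \<in> I \<Longrightarrow> openin (X i) (A i j)"
    and "manifold_space (adj_space I X A f)"
    and "\<not> Hausdorff_space (adj_space I X A f)"
    and "homeomorphic_boundaries I X A f"
    and "\<And>i j. i \<in> I \<Longrightarrow> j \<in> I \<Longrightarrow> i \<noteq> j \<Longrightarrow> extends_to_closures X A f i j (ft i j)"
  shows "(\<forall>i\<in>I. \<forall>j\<in>I. i \<noteq> j \<longrightarrow>
           homeomorphic_map (subtopology (adj_space I X A f) (glue_bd I X A f i j i))
                            (subtopology (adj_space I X A f) (glue_bd I X A f i j j))
                            (glue_map I X A f ft i j)) \<and>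
         (\<forall>i\<in>I. \<forall>j\<in>I. i \<noteq> j \<longrightarrow>
           (\<forall>x \<in> topspace (X i). \<forall>y \<in> topspace (X j).
              adj_incl I A f i x \<noteq> adj_incl I A f j y \<longrightarrow>
              (adj_incl I A f i x \<in> glue_bd I X A f i j i \<and>
                 glue_map I X A f ft i j (adj_incl I A f i x) = adj_incl I A f j y
               \<longleftrightarrow> Yrel (adj_space I X A f) (adj_incl I A f i x) (adj_incl I A f j y)))) \<and>
         (\<forall>i\<in>I. \<forall>j\<in>I.
           adj_incl I A f j ` topspace (X j) \<inter>
             (adj_space I X A f frontier_of (adj_incl I A f i ` topspace (X i)))
           = adj_incl I A f j ` topspace (X j) \<inter>
               Yset (adj_space I X A f) (adj_incl I A f i ` topspace (X i)))"
proof -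
  interpret Hausdorff_open_adjunction I X A f
    by unfold_locales (use assms(2-4) in auto)
  note ext = assms(8)
  \<comment> \<open>Injectivity of the inclusions turns the two conditions on classes into
    \<open>x \<in> ?D\<close> and \<open>ft i j x = y\<close>, the form required by
    \<open>Yrel_iff_extension\<close>.\<close>
  have "\<phi> i x \<in> glue_bd I X A f i j i \<and> glue_map I X A f ft i j (\<phi> i x) = \<phi> j y
      \<longleftrightarrow> Yrel M (\<phi> i x) (\<phi> j y)"
    if i: "i \<in> I" and j: "j \<in> I" and "i \<noteq> j" and x: "x \<in> topspace (X i)" and y: "y \<in> topspace (X j)"
      and ne: "\<phi> i x \<noteq> \<phi> j y" for i j x y
  proof -
    let ?D = "X i closure_of A i j - A i j"
    have D: "?D \<subseteq> topspace (X i)" using closure_of_subset_topspace by fastforce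
    have "\<phi> i x \<in> glue_bd I X A f i j i \<longleftrightarrow> x \<in> ?D"
      unfolding glue_bd_left[OF i j] by (rule inj_on_image_mem_iff[OF inj_incl[OF i] x D])
    moreover have "\<phi> j (ft i j x) = \<phi> j y \<longleftrightarrow> ft i j x = y" if "x \<in> ?D"
    proof -
      \<comment> \<open>\<open>\<phi> j\<close> is injective only on \<open>topspace (X j)\<close>.
        The extension sends the boundary of \<open>A i j\<close> to that of \<open>A j i\<close>, so
        the value lies there.\<close>
      have "ft i j x \<in> topspace (X j)"
        using that extends_to_closures_frontier[OF ext[OF i j \<open>i \<noteq> j\<close>] f_image[OF i j]]
          A_subset i j closure_of_subset_topspace[of "X j" "A j i"] by blast
      then show ?thesis using inj_incl[OF j] y by (auto dest: inj_onD)
    qed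
    ultimately show ?thesis
      using Yrel_iff_extension[OF i j ext[OF i j \<open>i \<noteq> j\<close>] x y ne] glue_map_incl[OF i x] by auto
  qed
  moreover have "\<phi> j ` topspace (X j) \<inter> M frontier_of (\<phi> i ` topspace (X i))
      = \<phi> j ` topspace (X j) \<inter> Yset M (\<phi> i ` topspace (X i))" if "i \<in> I" "j \<in> I" for i j
    by (rule frontier_of_piece_eq_Yset[OF that]) (rule ext[OF that])
  ultimately show ?thesis
    by (intro conjI ballI impI homeomorphic_glue_map ext) auto
qed

end
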